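(* Let $(Z,\rho_0)$ be a finite antipodal space with $Z=\{1,\dots,n\}$, $n\ge4$. (1) An admissible relation $R\neq\emptyset$ is antipodal if and only if $C(R)^*\ne\emptyset$. (2) The isometric embedding $i_{\rho_0}:\mathcal{M}(Z)\to(\mathbb{R}^n,\|\cdot\|_\infty)$ maps $\Phi^{-1}(R)$ onto $C(R)^*$ for any admissible relation $R\ne\emptyset$. (3) If $R$ is an antipodal relation, then $R\subseteq R_\rho$ for all $\rho\in E_{\rho_0}(C(R))$. (4) For admissible relations $R_1,R_2$ one has $C(R_1)\cap C(R_2)=C(R_1\cup R_2)$.
   Context: Let $Z=\{1,\dots,n\}$, $n\ge4$. A separating function on $Z$ is a symmetric function $\rho:Z\times Z\to[0,\infty)$ with $\rho(i,j)=0$ iff $i=j$. It is antipodal if $\max\rho=1$ and for every $i$ there is $j$ with $\rho(i,j)=1$; then $(Z,\rho)$ is called a (finite) antipodal space. Two separating functions $\rho,\rho'$ are Moebius equivalent if $\frac{\rho(i,k)\rho(j,l)}{\rho(i,l)\rho(j,k)}=\frac{\rho'(i,k)\rho'(j,l)}{\rho'(i,l)\rho'(j,k)}$ for all distinct $i,j,k,l$; equivalently (known fact) there is a unique function $\frac{d\rho'}{d\rho}:Z\to(0,\infty)$ with $\rho'(i,j)^2=\frac{d\rho'}{d\rho}(i)\frac{d\rho'}{d\rho}(j)\rho(i,j)^2$ for all $i,j$. Fix an antipodal function $\rho_0$ on $Z$. $\mathcal{UM}(Z,\rho_0)$ is the set of separating functions Moebius equivalent to $\rho_0$, with metric $d_{\mathcal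 M}(\rho_1,\rho_2)=\|\log\frac{d\rho_2}{d\rho_1}\|_\infty$, and $\mathcal{M}(Z)=\mathcal{M}(Z,\rho_0)$ is the subspace of antipodal functions in it. The map $i_{\rho_0}(\rho)=\log\frac{d\rho}{d\rho_0}\in\mathbb{R}^n$ is an isometry of $\mathcal{UM}(Z,\rho_0)$ onto $(\mathbb{R}^n,\|\cdot\|_\infty)$ with inverse $E_{\rho_0}$, $E_{\rho_0}(\tau)(i,j)^2=e^{\tau(i)+\tau(j)}\rho_0(i,j)^2$. Let $\Delta=\{(i,i):i\in Z\}$. For $\rho\in\mathcal{M}(Z)$ let $\Phi(\rho)=R_\rho=\{(i,j):\rho(i,j)=1\}\subseteq (Z\times Z)\setminus\Delta$. A symmetric relation $R\subseteq(Z\times Z)\setminus\Delta$ is admissible if for every $i\in Z$ there is $j\in Z$ with $(i,j)\in R$. A symmetric relation is antipodal if it is empty or equals $R_\rho$ for some $\rho\in\mathcal{M}(Z)$. For $i\ne j$ put $a_{ij}=\log(\rho_0(i,j)^2)$ and $l_{ij}(\tau)=\tau_i+\tau_j+a_{ij}$ for $\tau\in\mathbb{R}^n$. For $R$ admissible, $$C(R)=\{\tau\in\mathbb{R}^n: l_{ij}(\tau)=0\ \forall (i,j)\in R,\ l_{ij}(\tau)\le0\ \forall (i,j)\notin\Delta\},$$ $$C(R)^*=\{\tau\in\mathbb{R}^n: l_{ij}(\tau)=0\ \forall (i,j)\in R,\ l_{ij}(\tau)<0\ \forall (i,j)\notin R\cup\Delta\}.$$ By convention $C(\emptyset)=\emptyset$.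 *)

theory Defs
  imports "HOL-Analysis.Analysis"
begin

text \<open>
  The finite set \<open>Z\<close> is the universe of a finite type \<open>'n\<close>, and \<open>\<real>\<^sup>n\<close> is \<open>real ^ 'n\<close>.
  The type \<open>real ^ 'n\<close> carries the Euclidean norm; the maximum norm is \<open>infnorm\<close>.
\<close>

definition separating :: "('n \<Rightarrow> 'n \<Rightarrow> real) \<Rightarrow> bool" where
  "separating \<rho> \<longleftrightarrow>
     (\<forall>i j. \<rho> i j = \<rho> j i) \<and> (\<forall>i j. 0 \<le> \<rho> i j) \<and> (\<forall>i j. \<rho> i j = 0 \<longleftrightarrow> i = j)"

definition antipodal_function :: "('n::finite \<Rightarrow> 'n \<Rightarrow> real) \<Rightarrow> bool" where
  "antipodal_function \<rho> \<longleftrightarrow>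
     separating \<rho> \<and> Max (range (\<lambda>(i, j). \<rho> i j)) = 1 \<and> (\<forall>i. \<exists>j. \<rho> i j = 1)"

definition moebius_equiv :: "('n \<Rightarrow> 'n \<Rightarrow> real) \<Rightarrow> ('n \<Rightarrow> 'n \<Rightarrow> real) \<Rightarrow> bool" where
  "moebius_equiv \<rho> \<rho>' \<longleftrightarrow>
     (\<forall>i j k l. distinct [i, j, k, l] \<longrightarrow>
        (\<rho> i k * \<rho> j l) / (\<rho> i l * \<rho> j k) = (\<rho>' i k * \<rho>' j l) / (\<rho>' i l * \<rho>' j k))"

text \<open>
  \<open>moebius_deriv \<rho>' \<rho>\<close> is \<open>d\<rho>'/d\<rho>\<close>. It is meaningful only for Moebius equivalent separating
  functions on at least four points, where existence and uniqueness hold.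
\<close>

definition moebius_deriv :: "('n \<Rightarrow> 'n \<Rightarrow> real) \<Rightarrow> ('n \<Rightarrow> 'n \<Rightarrow> real) \<Rightarrow> 'n \<Rightarrow> real" where
  "moebius_deriv \<rho>' \<rho> =
     (THE f. (\<forall>i. 0 < f i) \<and> (\<forall>i j. (\<rho>' i j)\<^sup>2 = f i * f j * (\<rho> i j)\<^sup>2))"

definition UM :: "('n \<Rightarrow> 'n \<Rightarrow> real) \<Rightarrow> ('n \<Rightarrow> 'n \<Rightarrow> real) set" where
  "UM \<rho>0 = {\<rho>. separating \<rho> \<and> moebius_equiv \<rho> \<rho>0}"

definition Moeb :: "('n::finite \<Rightarrow> 'n \<Rightarrow> real) \<Rightarrow> ('n \<Rightarrow> 'n \<Rightarrow> real) set" where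
  "Moeb \<rho>0 = {\<rho> \<in> UM \<rho>0. antipodal_function \<rho>}"

definition dist_M :: "('n::finite \<Rightarrow> 'n \<Rightarrow> real) \<Rightarrow> ('n \<Rightarrow> 'n \<Rightarrow> real) \<Rightarrow> real" where
  "dist_M \<rho>1 \<rho>2 = infnorm (\<chi> i. ln (moebius_deriv \<rho>2 \<rho>1 i))"

definition log_embed :: "('n::finite \<Rightarrow> 'n \<Rightarrow> real) \<Rightarrow> ('n \<Rightarrow> 'n \<Rightarrow> real) \<Rightarrow> real ^ 'n" where
  "log_embed \<rho>0 \<rho> = (\<chi> i. ln (moebius_deriv \<rho> \<rho>0 i))"

definition exp_map :: "('n::finite \<Rightarrow> 'n \<Rightarrow> real) \<Rightarrow> real ^ 'n \<Rightarrow> 'n \<Rightarrow> 'n \<Rightarrow> real" where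
  "exp_map \<rho>0 \<tau> i j = sqrt (exp (\<tau> $ i + \<tau> $ j) * (\<rho>0 i j)\<^sup>2)"

definition antipodal_pairs :: "('n \<Rightarrow> 'n \<Rightarrow> real) \<Rightarrow> ('n \<times> 'n) set" where
  "antipodal_pairs \<rho> = {(i, j). \<rho> i j = 1}"

definition admissible :: "('n \<times> 'n) set \<Rightarrow> bool" where
  "admissible R \<longleftrightarrow> sym R \<and> R \<subseteq> - Id \<and> (\<forall>i. \<exists>j. (i, j) \<in> R)"

definition antipodal_relation :: "('n::finite \<Rightarrow> 'n \<Rightarrow> real) \<Rightarrow> ('n \<times> 'n) set \<Rightarrow> bool" where
  "antipodal_relation \<rho>0 R \<longleftrightarrow>
     sym R \<and> R \<subseteq> - Id \<and> (R = {} \<or> (\<exists>\<rho> \<in> Moeb \<rho>0. R = antipodal_pairs \<rho>))"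

text \<open>\<open>lin_form \<rho>0 i j\<close> is the affine function \<open>l\<^sub>i\<^sub>j\<close>, used only for \<open>i \<noteq> j\<close>.\<close>

definition lin_form :: "('n::finite \<Rightarrow> 'n \<Rightarrow> real) \<Rightarrow> 'n \<Rightarrow> 'n \<Rightarrow> real ^ 'n \<Rightarrow> real" where
  "lin_form \<rho>0 i j \<tau> = \<tau> $ i + \<tau> $ j + ln ((\<rho>0 i j)\<^sup>2)"

text \<open>
  The convention \<open>C(\<emptyset>) = \<emptyset>\<close> is part of \<open>closed_cell\<close>. The open cell is only used
  for admissible relations, which are never empty.
\<close>

definition closed_cell :: "('n::finite \<Rightarrow> 'n \<Rightarrow> real) \<Rightarrow> ('n \<times> 'n) set \<Rightarrow> (real ^ 'n) set" where
  "closed_cell \<rho>0 R =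
     (if R = {} then {}
      else {\<tau>. (\<forall>(i, j) \<in> R. lin_form \<rho>0 i j \<tau> = 0) \<and>
               (\<forall>(i, j) \<in> - Id. lin_form \<rho>0 i j \<tau> \<le> 0)})"

definition open_cell :: "('n::finite \<Rightarrow> 'n \<Rightarrow> real) \<Rightarrow> ('n \<times> 'n) set \<Rightarrow> (real ^ 'n) set" where
  "open_cell \<rho>0 R =
     {\<tau>. (\<forall>(i, j) \<in> R. lin_form \<rho>0 i j \<tau> = 0) \<and>
          (\<forall>(i, j) \<in> - (R \<union> Id). lin_form \<rho>0 i j \<tau> < 0)}"

end

theory Submission imports Defs begin

text \<open>
  In logarithmic coordinates, Moebius equivalence says that
  \<open>S i j = ln (\<rho>' i j / \<rho> i j)\<close> satisfies \<open>S i k + S j l = S i l + S j k\<close>. Hence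
  \<open>S i j + S i k - S j k\<close> depends on \<open>i\<close> only, and this is the logarithm of the derivative
  \<open>d\<rho>'/d\<rho>\<close> at \<open>i\<close>. So \<open>log_embed \<rho>0\<close> and \<open>exp_map \<rho>0\<close> are inverse to each other, and
  \<open>ln ((exp_map \<rho>0 \<tau> i j)\<^sup>2) = lin_form \<rho>0 i j \<tau>\<close> turns the distances \<open>1\<close> and the bound \<open>\<le> 1\<close>
  into the equations and inequalities of the cells.
\<close>

section \<open>Conformal factors and the uniqueness of the derivative\<close>

text \<open>This is the predicate under the \<open>THE\<close> of \<open>moebius_deriv\<close>;
  naming it lets existence and uniqueness be proved separately.\<close>

definition conformal_factor :: "('n \<Rightarrow> real) \<Rightarrow> ('n \<Rightarrow> 'n \<Rightarrow> real) \<Rightarrow> ('n \<Rightarrow> 'n \<Rightarrow> real) \<Rightarrow> bool" where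
  "conformal_factor f \<rho>' \<rho> \<longleftrightarrow> (\<forall>i. 0 < f i) \<and> (\<forall>i j. (\<rho>' i j)\<^sup>2 = f i * f j * (\<rho> i j)\<^sup>2)"

lemma separating_pos:
  assumes "separating \<rho>" "i \<noteq> j"
  shows "0 < \<rho> i j"
  using assms unfolding separating_def by (metis order_le_less)

lemma separating_same: "separating \<rho> \<Longrightarrow> \<rho> i i = 0"
  by (simp add: separating_def)

lemma conformal_factor_sqrt:
  assumes "conformal_factor f \<rho>' \<rho>" "separating \<rho>" "separating \<rho>'"
  shows "\<rho>' i j = sqrt (f i) * sqrt (f j) * \<rho> i j"
proof -
  have "\<rho>' i j = sqrt ((\<rho>' i j)\<^sup>2)" "\<rho> i j = sqrt ((\<rho> i j)\<^sup>2)"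
    using assms(2,3) by (simp_all add: separating_def)
  then show ?thesis
    using assms(1) by (metis conformal_factor_def real_sqrt_mult)
qed

lemma obtain_two_distinct:
  fixes i :: "'n::finite"
  assumes "3 \<le> CARD('n)"
  obtains j k where "distinct [i, j, k]"
proof -
  have "card {i} \<noteq> CARD('n)" using assms by simp
  then have "{i} \<noteq> UNIV" by metis
  then obtain j where j: "j \<noteq> i" by blast
  have "card {i, j} \<noteq> CARD('n)" using assms j by simp
  then have "{i, j} \<noteq> UNIV" by metis
  then obtain k where "k \<notin> {i, j}" by blast
  with j show ?thesis by (intro that[of j k]) auto
qed

text \<open>Off the diagonal \<rho> cancels, so all products \<open>f a * f b\<close> are
  determined. Three points then recover the factor: \<open>(f i)\<^sup>2\<close> is
  \<open>(f i * f j) * (f i * f k) / (f j * f k)\<close>, and positivity fixes the root.\<close>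

lemma conformal_factor_unique:
  fixes \<rho> :: "'n::finite \<Rightarrow> 'n \<Rightarrow> real"
  assumes "3 \<le> CARD('n)" and "separating \<rho>"
    and "conformal_factor f \<rho>' \<rho>" and "conformal_factor g \<rho>' \<rho>"
  shows "f = g"
proof
  fix i :: 'n
  obtain j k where d: "distinct [i, j, k]"
    using obtain_two_distinct[OF assms(1)] .
  have eq: "f a * f b = g a * g b" if "a \<noteq> b" for a b
    using assms(3,4) separating_pos[OF assms(2) that] unfolding conformal_factor_def
    by (metis less_irrefl mult_cancel_right zero_eq_power2)
  have pos: "f a > 0" "g a > 0" for a
    using assms(3,4) by (auto simp: conformal_factor_def)
  have "(f i)\<^sup>2 * (f j * f k) = (f i * f j) * (f i * f k)"
    by (simp add: power2_eq_square)
  also have "\<dots> = (g i * g j) * (g i * g k)" using eq d by simp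
  also have "\<dots> = (g i)\<^sup>2 * (f j * f k)" using eq[of j k] d by (simp add: power2_eq_square)
  finally have "(f i)\<^sup>2 = (g i)\<^sup>2" using pos[of j] pos[of k] by simp
  then show "f i = g i" using pos[of i] by (simp add: power2_eq_iff_nonneg)
qed

lemma moebius_deriv_eqI:
  fixes \<rho> :: "'n::finite \<Rightarrow> 'n \<Rightarrow> real"
  assumes "3 \<le> CARD('n)" and "separating \<rho>" and "conformal_factor f \<rho>' \<rho>"
  shows "moebius_deriv \<rho>' \<rho> = f"
  unfolding moebius_deriv_def conformal_factor_def[symmetric]
  using assms(3) conformal_factor_unique[OF assms(1,2) _ assms(3)] by (rule the_equality)

section \<open>Existence of the derivative from cross-ratios\<close>

text \<open>\<open>G\<close> is twice a Gromov product based at \<open>i\<close>. The identity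
  \<open>cross\<close> allows its other two arguments to be exchanged, and in
  \<open>G i j k + G j i k\<close> everything but \<open>2 * S i j\<close> cancels.\<close>

lemma log_cross_ratio_potential:
  fixes S :: "'n::finite \<Rightarrow> 'n \<Rightarrow> real"
  assumes "3 \<le> CARD('n)" and sym: "\<And>i j. S i j = S j i"
    and cross: "\<And>i j k l. distinct [i, j, k, l] \<Longrightarrow> S i k + S j l = S i l + S j k"
  obtains F where "\<And>i j. i \<noteq> j \<Longrightarrow> 2 * S i j = F i + F j"
proof -
  define G where "G i j k = S i j + S i k - S j k" for i j k
  have G_sym: "G i j k = G i k j" for i j k
    using sym by (simp add: G_def)
  \<comment> \<open>For \<open>k\<close> different from \<open>l\<close> this is
    \<open>cross\<close> with \<open>S i j\<close> added and terms rearranged.\<close>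
  have G_step: "G i j k = G i j l" if "distinct [i, j, k]" "distinct [i, j, l]" for i j k l
    using cross[of i j k l] that by (cases "k = l") (auto simp: G_def)
  have G_indep: "G i j k = G i j' k'"
    if "distinct [i, j, k]" "distinct [i, j', k']" for i j k j' k'
  \<comment> \<open>Arguments are exchanged one at a time through the pair \<open>j\<close>,
    \<open>k'\<close>, which must be distinct. If they coincide, both pairs contain \<open>j\<close>
    and one exchange suffices.\<close>
  proof (cases "k' = j")
    case True
    then show ?thesis using G_step[of i j k j'] G_sym that by auto
  next
    case False
    then have "G i j k = G i j k'" using that by (intro G_step) auto
    also have "\<dots> = G i k' j" by (rule G_sym)
    also have "\<dots> = G i k' j'" using that False by (intro G_step) auto
    also have "\<dots> = G i j' k'" by (rule G_sym)
    finally show ?thesis .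
  qed
  have "\<exists>c. \<forall>j k. distinct [i, j, k] \<longrightarrow> G i j k = c" for i
    using G_indep by meson
  then obtain F where F: "\<And>i j k. distinct [i, j, k] \<Longrightarrow> G i j k = F i" by metis
  have "2 * S i j = F i + F j" if "i \<noteq> j" for i j
  proof -
    have "card {i, j} \<noteq> CARD('n)" using assms(1) that by simp
    then have "{i, j} \<noteq> UNIV" by metis
    then obtain k where "k \<notin> {i, j}" by blast
    then have "F i = G i j k" "F j = G j i k" using F[of i j k] F[of j i k] that by auto
    then show ?thesis using sym[of i j] by (simp add: G_def)
  qed
  then show ?thesis using that by blast
qed

lemma conformal_factor_exists:
  fixes \<rho> :: "'n::finite \<Rightarrow> 'n \<Rightarrow> real"
  assumes "3 \<le> CARD('n)" and "separating \<rho>" and "separating \<rho>'" and "moebius_equiv \<rho>' \<rho>"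
  obtains f where "conformal_factor f \<rho>' \<rho>"
proof -
  define S where "S i j = ln (\<rho>' i j) - ln (\<rho> i j)" for i j
  have pos: "\<rho> i j > 0" "\<rho>' i j > 0" if "i \<noteq> j" for i j
    using assms(2,3) that by (auto intro: separating_pos)
  have cross: "S i k + S j l = S i l + S j k" if "distinct [i, j, k, l]" for i j k l
  proof -
    have ln_ratio: "ln ((\<sigma> i k * \<sigma> j l) / (\<sigma> i l * \<sigma> j k)) =
        ln (\<sigma> i k) + ln (\<sigma> j l) - ln (\<sigma> i l) - ln (\<sigma> j k)"
      if "\<And>a b. a \<noteq> b \<Longrightarrow> \<sigma> a b > 0" for \<sigma> :: "'n \<Rightarrow> 'n \<Rightarrow> real"
      using \<open>distinct [i, j, k, l]\<close> that[of i k] that[of j l] that[of i l] that[of j k]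
      by (simp add: ln_divide_pos ln_mult_pos)
    have "(\<rho>' i k * \<rho>' j l) / (\<rho>' i l * \<rho>' j k) = (\<rho> i k * \<rho> j l) / (\<rho> i l * \<rho> j k)"
      using assms(4) that unfolding moebius_equiv_def by blast
    then show ?thesis
      using ln_ratio[of \<rho>] ln_ratio[of \<rho>'] pos unfolding S_def by simp
  qed
  have S_sym: "S i j = S j i" for i j
    using assms(2,3) unfolding S_def separating_def by metis
  obtain F where F: "\<And>i j. i \<noteq> j \<Longrightarrow> 2 * S i j = F i + F j"
    using log_cross_ratio_potential[of S, OF assms(1) S_sym cross] by blast
  have "(\<rho>' i j)\<^sup>2 = exp (F i) * exp (F j) * (\<rho> i j)\<^sup>2" for i j
  \<comment> \<open>The potential \<open>F\<close> says nothing about the diagonal, but both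
    distances vanish there.\<close>
  proof (cases "i = j")
    case True
    then show ?thesis by (simp add: separating_same assms(2,3))
  next
    case False
    have "exp (F i) * exp (F j) = (exp (S i j))\<^sup>2"
      by (simp add: F[OF False, symmetric] exp_add[symmetric] power2_eq_square)
    moreover have "\<rho>' i j = exp (S i j) * \<rho> i j"
      using pos[OF False] by (simp add: S_def exp_diff)
    ultimately show ?thesis by (simp add: power_mult_distrib)
  qed
  then show ?thesis
    using that[of "\<lambda>i. exp (F i)"] by (simp add: conformal_factor_def)
qed

text \<open>Existence and uniqueness together make the definite description satisfy its defining
  property.\<close>

lemma conformal_factor_moebius_deriv:
  fixes \<rho> :: "'n::finite \<Rightarrow> 'n \<Rightarrow> real"
  assumes "3 \<le> CARD('n)" and "separating \<rho>" and "\<rho>' \<in> UM \<rho>"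
  shows "conformal_factor (moebius_deriv \<rho>' \<rho>) \<rho>' \<rho>"
  using assms conformal_factor_exists[OF assms(1,2)] moebius_deriv_eqI[OF assms(1,2)]
  unfolding UM_def by (metis mem_Collect_eq)

text \<open>Each of the four points occurs once in the numerator and once in the denominator, so
  both acquire the same constant \<open>c\<close>, which cancels. If a denominator is 0, both
  quotients are 0 by the convention for division.\<close>

lemma conformal_factor_imp_UM:
  assumes "conformal_factor f \<rho>' \<rho>" and "separating \<rho>" and "separating \<rho>'"
  shows "\<rho>' \<in> UM \<rho>"
proof -
  have f: "sqrt (f i) > 0" for i
    using assms(1) by (simp add: conformal_factor_def)
  have "(\<rho>' i k * \<rho>' j l) / (\<rho>' i l * \<rho>' j k) = (\<rho> i k * \<rho> j l) / (\<rho> i l * \<rho> j k)" for i j k l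
  proof -
    define c where "c = sqrt (f i) * sqrt (f j) * sqrt (f k) * sqrt (f l)"
    have "c \<noteq> 0" using f by (simp add: c_def less_imp_neq[symmetric])
    have "\<rho>' i k * \<rho>' j l = c * (\<rho> i k * \<rho> j l)" "\<rho>' i l * \<rho>' j k = c * (\<rho> i l * \<rho> j k)"
      by (simp_all add: conformal_factor_sqrt[OF assms] c_def mult_ac)
    with \<open>c \<noteq> 0\<close> show ?thesis by simp
  qed
  then show ?thesis using assms(3) by (auto simp: UM_def moebius_equiv_def)
qed

section \<open>The mutually inverse maps \<open>exp_map\<close> and \<open>log_embed\<close>\<close>

lemma conformal_factor_exp_map:
  "conformal_factor (\<lambda>i. exp (\<tau> $ i)) (exp_map \<rho> \<tau>) \<rho>"
  by (simp add: conformal_factor_def exp_map_def exp_add)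

lemma separating_exp_map:
  assumes "separating \<rho>"
  shows "separating (exp_map \<rho> \<tau>)"
  using assms by (auto simp: separating_def exp_map_def add.commute)

lemma exp_map_in_UM:
  assumes "separating \<rho>"
  shows "exp_map \<rho> \<tau> \<in> UM \<rho>"
  using conformal_factor_imp_UM[OF conformal_factor_exp_map assms separating_exp_map[OF assms]] .

lemma log_embed_exp_map:
  fixes \<rho> :: "'n::finite \<Rightarrow> 'n \<Rightarrow> real"
  assumes "3 \<le> CARD('n)" and "separating \<rho>"
  shows "log_embed \<rho> (exp_map \<rho> \<tau>) = \<tau>"
  by (simp add: log_embed_def moebius_deriv_eqI[OF assms conformal_factor_exp_map])

lemma exp_map_log_embed:
  fixes \<rho> :: "'n::finite \<Rightarrow> 'n \<Rightarrow> real"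
  assumes "3 \<le> CARD('n)" and "separating \<rho>" and "\<rho>' \<in> UM \<rho>"
  shows "exp_map \<rho> (log_embed \<rho> \<rho>') = \<rho>'"
proof (intro ext)
  fix i j
  have "conformal_factor (moebius_deriv \<rho>' \<rho>) \<rho>' \<rho>"
    using conformal_factor_moebius_deriv[OF assms] .
  \<comment> \<open>Nonnegativity makes \<rho>' the root chosen by \<open>sqrt\<close> in
    \<open>exp_map\<close>.\<close>
  moreover have "0 \<le> \<rho>' i j"
    using assms(3) by (simp add: UM_def separating_def)
  ultimately show "exp_map \<rho> (log_embed \<rho> \<rho>') i j = \<rho>' i j"
    by (simp add: exp_map_def log_embed_def exp_add conformal_factor_def real_sqrt_unique)
qed

section \<open>Comparing distances with 1 through the signs of the affine forms\<close>

lemma ln_exp_map: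
  assumes "separating \<rho>" "i \<noteq> j"
  shows "2 * ln (exp_map \<rho> \<tau> i j) = lin_form \<rho> i j \<tau>"
  using separating_pos[OF assms]
  by (simp add: exp_map_def lin_form_def ln_sqrt ln_mult)

text \<open>The diagonal is excluded on the right because \<open>lin_form\<close> there contains
  \<open>ln 0\<close> and can vanish, while the distance is 0.\<close>

lemma exp_map_eq_1_iff:
  assumes "separating \<rho>"
  shows "exp_map \<rho> \<tau> i j = 1 \<longleftrightarrow> i \<noteq> j \<and> lin_form \<rho> i j \<tau> = 0"
proof (cases "i = j")
  case True
  then show ?thesis using separating_same[OF assms] by (simp add: exp_map_def)
next
  case False
  then show ?thesis
    using separating_pos[OF separating_exp_map[OF assms] False, of \<tau>] ln_exp_map[OF assms False, of \<tau>]
      ln_eq_zero_iff[of "exp_map \<rho> \<tau> i j"] by auto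
qed

lemma exp_map_le_1_iff:
  assumes "separating \<rho>" "i \<noteq> j"
  shows "exp_map \<rho> \<tau> i j \<le> 1 \<longleftrightarrow> lin_form \<rho> i j \<tau> \<le> 0"
  using separating_pos[OF separating_exp_map[OF assms(1)] assms(2), of \<tau>] ln_exp_map[OF assms, of \<tau>]
    ln_le_zero_iff[of "exp_map \<rho> \<tau> i j"] by linarith

text \<open>This trades the maximum for a bound off the diagonal, which is the shape of the
  inequalities of the cells.\<close>

lemma antipodal_function_iff:
  fixes \<rho> :: "'n::finite \<Rightarrow> 'n \<Rightarrow> real"
  shows "antipodal_function \<rho> \<longleftrightarrow>
    separating \<rho> \<and> (\<forall>i j. i \<noteq> j \<longrightarrow> \<rho> i j \<le> 1) \<and> (\<forall>i. \<exists>j. \<rho> i j = 1)"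
proof -
  have "Max (range (\<lambda>(i, j). \<rho> i j)) = 1 \<longleftrightarrow> (\<forall>i j. i \<noteq> j \<longrightarrow> \<rho> i j \<le> 1)"
    if "separating \<rho>" and ex: "\<forall>i. \<exists>j. \<rho> i j = 1"
  proof -
    obtain i j where "\<rho> i j = 1" using ex by blast
    then have "1 \<in> range (\<lambda>(i, j). \<rho> i j)"
      by (intro range_eqI[of _ _ "(i, j)"]) simp
    \<comment> \<open>Since the value 1 is attained, it is the maximum as soon as it is an upper
      bound.\<close>
    then have "Max (range (\<lambda>(i, j). \<rho> i j)) = 1 \<longleftrightarrow> (\<forall>i j. \<rho> i j \<le> 1)"
      by (subst Max_eq_iff) auto
    moreover have "\<rho> i i \<le> 1" for i
      using \<open>separating \<rho>\<close> by (simp add: separating_same)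
    ultimately show ?thesis by metis
  qed
  then show ?thesis unfolding antipodal_function_def by meson
qed

lemma exp_map_in_Moeb_iff:
  assumes "separating \<rho>"
  shows "exp_map \<rho> \<tau> \<in> Moeb \<rho> \<longleftrightarrow>
    (\<forall>i j. i \<noteq> j \<longrightarrow> lin_form \<rho> i j \<tau> \<le> 0) \<and> (\<forall>i. \<exists>j. i \<noteq> j \<and> lin_form \<rho> i j \<tau> = 0)"
  using exp_map_in_UM[OF assms, of \<tau>] separating_exp_map[OF assms, of \<tau>]
  by (auto simp: Moeb_def antipodal_function_iff exp_map_eq_1_iff[OF assms] exp_map_le_1_iff[OF assms])

section \<open>Open cells as images of the fibres of \<Phi>\<close>

text \<open>The off-diagonal zeros of \<open>lin_form\<close> are the antipodal pairs of
  \<open>exp_map \<rho> \<tau>\<close>. Admissibility gives every point a partner at distance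
  1.\<close>

lemma open_cell_iff:
  assumes "separating \<rho>" and "admissible R"
  shows "\<tau> \<in> open_cell \<rho> R \<longleftrightarrow> exp_map \<rho> \<tau> \<in> Moeb \<rho> \<and> antipodal_pairs (exp_map \<rho> \<tau>) = R"
proof -
  have pairs: "antipodal_pairs (exp_map \<rho> \<tau>) = {(i, j). i \<noteq> j \<and> lin_form \<rho> i j \<tau> = 0}"
    by (simp add: antipodal_pairs_def exp_map_eq_1_iff[OF assms(1)])
  have R: "R \<subseteq> - Id" "\<And>i. \<exists>j. (i, j) \<in> R"
    using assms(2) by (auto simp: admissible_def)
  show ?thesis
    unfolding pairs exp_map_in_Moeb_iff[OF assms(1)]
  proof
    assume "\<tau> \<in> open_cell \<rho> R"
    then have eq: "\<And>i j. (i, j) \<in> R \<Longrightarrow> lin_form \<rho> i j \<tau> = 0"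
      and less: "\<And>i j. (i, j) \<notin> R \<Longrightarrow> i \<noteq> j \<Longrightarrow> lin_form \<rho> i j \<tau> < 0"
      by (auto simp: open_cell_def)
    \<comment> \<open>The strict inequalities outside \<open>R\<close> exclude further zeros, so
      equality holds and not just inclusion.\<close>
    have "{(i, j). i \<noteq> j \<and> lin_form \<rho> i j \<tau> = 0} = R"
      using eq less R(1) by force
    moreover have "lin_form \<rho> i j \<tau> \<le> 0" if "i \<noteq> j" for i j
      using eq[of i j] less[of i j] that by fastforce
    moreover have "\<exists>j. i \<noteq> j \<and> lin_form \<rho> i j \<tau> = 0" for i
      using R eq by (metis ComplD IdI subsetD)
    ultimately show "((\<forall>i j. i \<noteq> j \<longrightarrow> lin_form \<rho> i j \<tau> \<le> 0) \<and>
        (\<forall>i. \<exists>j. i \<noteq> j \<and> lin_form \<rho> i j \<tau> = 0)) \<and> {(i, j). i \<noteq> j \<and> lin_form \<rho> i j \<tau> = 0} = R"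
      by blast
  next
    assume "((\<forall>i j. i \<noteq> j \<longrightarrow> lin_form \<rho> i j \<tau> \<le> 0) \<and>
        (\<forall>i. \<exists>j. i \<noteq> j \<and> lin_form \<rho> i j \<tau> = 0)) \<and> {(i, j). i \<noteq> j \<and> lin_form \<rho> i j \<tau> = 0} = R"
    \<comment> \<open>Outside \<open>R\<close> an off-diagonal form is at most 0 and not 0, hence
      negative.\<close>
    then show "\<tau> \<in> open_cell \<rho> R"
      by (force simp: open_cell_def order_less_le)
  qed
qed

text \<open>By \<open>open_cell_iff\<close>, \<open>exp_map\<close> carries the cell into the fibre,
  and it inverts \<open>log_embed\<close>. An image is empty only if its source is, so the criterion
  for antipodal relations follows as well.\<close>

lemma log_embed_image_eq_open_cell:
  fixes \<rho> :: "'n::finite \<Rightarrow> 'n \<Rightarrow> real"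
  assumes "3 \<le> CARD('n)" and "separating \<rho>" and "admissible R"
  shows "log_embed \<rho> ` {\<rho>' \<in> Moeb \<rho>. antipodal_pairs \<rho>' = R} = open_cell \<rho> R"
proof
  show "log_embed \<rho> ` {\<rho>' \<in> Moeb \<rho>. antipodal_pairs \<rho>' = R} \<subseteq> open_cell \<rho> R"
  proof (rule image_subsetI)
    fix \<rho>' assume \<rho>': "\<rho>' \<in> {\<rho>' \<in> Moeb \<rho>. antipodal_pairs \<rho>' = R}"
    then have "exp_map \<rho> (log_embed \<rho> \<rho>') = \<rho>'"
      by (intro exp_map_log_embed[OF assms(1,2)]) (simp add: Moeb_def)
    with \<rho>' show "log_embed \<rho> \<rho>' \<in> open_cell \<rho> R"
      by (simp add: open_cell_iff[OF assms(2,3)])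
  qed
  show "open_cell \<rho> R \<subseteq> log_embed \<rho> ` {\<rho>' \<in> Moeb \<rho>. antipodal_pairs \<rho>' = R}"
  proof
    fix \<tau> assume "\<tau> \<in> open_cell \<rho> R"
    then have "exp_map \<rho> \<tau> \<in> {\<rho>' \<in> Moeb \<rho>. antipodal_pairs \<rho>' = R}"
      by (simp add: open_cell_iff[OF assms(2,3)])
    then have "log_embed \<rho> (exp_map \<rho> \<tau>) \<in> log_embed \<rho> ` {\<rho>' \<in> Moeb \<rho>. antipodal_pairs \<rho>' = R}"
      by (rule imageI)
    then show "\<tau> \<in> log_embed \<rho> ` {\<rho>' \<in> Moeb \<rho>. antipodal_pairs \<rho>' = R}"
      by (simp only: log_embed_exp_map[OF assms(1,2)])
  qed
qed

section \<open>The isometry property\<close>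

text \<open>This is the chain rule: the derivative of \<rho>2 over \<rho>1 is the quotient
  \<open>g i / f i\<close> of their derivatives over \<rho>, and the logarithm turns it into a
  difference.\<close>

lemma infnorm_log_embed_diff:
  fixes \<rho> :: "'n::finite \<Rightarrow> 'n \<Rightarrow> real"
  assumes "3 \<le> CARD('n)" and "separating \<rho>" and "\<rho>1 \<in> UM \<rho>" and "\<rho>2 \<in> UM \<rho>"
  shows "infnorm (log_embed \<rho> \<rho>1 - log_embed \<rho> \<rho>2) = dist_M \<rho>1 \<rho>2"
proof -
  define f g where "f = moebius_deriv \<rho>1 \<rho>" and "g = moebius_deriv \<rho>2 \<rho>"
  have "conformal_factor f \<rho>1 \<rho>" "conformal_factor g \<rho>2 \<rho>"
    unfolding f_def g_def using conformal_factor_moebius_deriv assms by blast+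
  then have pos: "f i > 0" "g i > 0" and sq: "(\<rho>1 i j)\<^sup>2 = f i * f j * (\<rho> i j)\<^sup>2"
    "(\<rho>2 i j)\<^sup>2 = g i * g j * (\<rho> i j)\<^sup>2" for i j
    by (auto simp: conformal_factor_def)
  have nz: "f i \<noteq> 0" for i using pos(1)[of i] by simp
  have "conformal_factor (\<lambda>i. g i / f i) \<rho>2 \<rho>1"
    using pos nz by (simp add: conformal_factor_def sq)
  then have "moebius_deriv \<rho>2 \<rho>1 = (\<lambda>i. g i / f i)"
    using assms(3) by (intro moebius_deriv_eqI[OF assms(1)]) (simp_all add: UM_def)
  then have "(\<chi> i. ln (moebius_deriv \<rho>2 \<rho>1 i)) = log_embed \<rho> \<rho>2 - log_embed \<rho> \<rho>1"
    using pos by (simp add: log_embed_def vec_eq_iff ln_divide_pos flip: f_def g_def)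
  \<comment> \<open>The two differences have opposite signs, which the norm ignores.\<close>
  then show ?thesis by (simp add: dist_M_def infnorm_sub)
qed

section \<open>Closed cells\<close>

text \<open>Nonemptiness keeps all three sets away from the convention for the empty relation. The
  upper bounds are common to all cells, and equations over a union split.\<close>

lemma closed_cell_Int:
  assumes "R1 \<noteq> {}" and "R2 \<noteq> {}"
  shows "closed_cell \<rho> R1 \<inter> closed_cell \<rho> R2 = closed_cell \<rho> (R1 \<union> R2)"
  using assms by (auto simp: closed_cell_def)

lemma antipodal_relation_admissible:
  assumes "antipodal_relation \<rho> R" and "R \<noteq> {}"
  shows "admissible R"
  using assms
  by (auto simp: antipodal_relation_def admissible_def Moeb_def antipodal_function_iff
      antipodal_pairs_def)

text \<open>As the inequalities are weak, zeros outside \<open>R\<close> may occur, so only an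
  inclusion results. The partners supplied by \<open>R\<close> still make the function
  antipodal.\<close>

lemma exp_map_closed_cell:
  assumes "separating \<rho>" and "antipodal_relation \<rho> R" and "\<tau> \<in> closed_cell \<rho> R"
  shows "exp_map \<rho> \<tau> \<in> Moeb \<rho> \<and> R \<subseteq> antipodal_pairs (exp_map \<rho> \<tau>)"
proof -
  \<comment> \<open>The convention that the cell of the empty relation is empty enters here.\<close>
  have "R \<noteq> {}" using assms(3) by (auto simp: closed_cell_def)
  with assms(2) have R: "R \<subseteq> - Id" "\<And>i. \<exists>j. (i, j) \<in> R"
    using antipodal_relation_admissible by (auto simp: admissible_def)
  have eq: "\<And>i j. (i, j) \<in> R \<Longrightarrow> lin_form \<rho> i j \<tau> = 0"
    and le: "\<And>i j. i \<noteq> j \<Longrightarrow> lin_form \<rho> i j \<tau> \<le> 0"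
    using assms(3) \<open>R \<noteq> {}\<close> by (auto simp: closed_cell_def)
  have "\<exists>j. i \<noteq> j \<and> lin_form \<rho> i j \<tau> = 0" for i
    using R eq by (metis ComplD IdI subsetD)
  then have "exp_map \<rho> \<tau> \<in> Moeb \<rho>"
    using le by (simp add: exp_map_in_Moeb_iff[OF assms(1)])
  moreover have "R \<subseteq> antipodal_pairs (exp_map \<rho> \<tau>)"
    using R(1) eq by (auto simp: antipodal_pairs_def exp_map_eq_1_iff[OF assms(1)])
  ultimately show ?thesis ..
qed

theorem lemma3p2p1:
  fixes \<rho>0 :: "'n::finite \<Rightarrow> 'n \<Rightarrow> real"
  assumes "4 \<le> CARD('n)"
    and "antipodal_function \<rho>0"
  shows "(\<forall>R. admissible R \<and> R \<noteq> {} \<longrightarrow>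
            (antipodal_relation \<rho>0 R \<longleftrightarrow> open_cell \<rho>0 R \<noteq> {}))
       \<and> ((\<forall>\<rho>1 \<in> Moeb \<rho>0. \<forall>\<rho>2 \<in> Moeb \<rho>0.
              infnorm (log_embed \<rho>0 \<rho>1 - log_embed \<rho>0 \<rho>2) = dist_M \<rho>1 \<rho>2)
          \<and> (\<forall>R. admissible R \<and> R \<noteq> {} \<longrightarrow>
               log_embed \<rho>0 ` {\<rho> \<in> Moeb \<rho>0. antipodal_pairs \<rho> = R} = open_cell \<rho>0 R))
       \<and> (\<forall>R. antipodal_relation \<rho>0 R \<longrightarrow>
            (\<forall>\<rho> \<in> exp_map \<rho>0 ` closed_cell \<rho>0 R. \<rho> \<in> Moeb \<rho>0 \<and> R \<subseteq> antipodal_pairs \<rho>))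
       \<and> (\<forall>R1 R2. admissible R1 \<and> admissible R2 \<longrightarrow>
            closed_cell \<rho>0 R1 \<inter> closed_cell \<rho>0 R2 = closed_cell \<rho>0 (R1 \<union> R2))"
proof (intro conjI allI impI ballI)
  have card: "3 \<le> CARD('n)"
    using assms(1) by simp
  have sep: "separating \<rho>0"
    using assms(2) by (simp add: antipodal_function_def)
  show "antipodal_relation \<rho>0 R \<longleftrightarrow> open_cell \<rho>0 R \<noteq> {}" if "admissible R \<and> R \<noteq> {}" for R
  proof -
    \<comment> \<open>For nonempty \<open>R\<close> the alternative \<open>R = {}\<close> drops out,
      so being antipodal means having a nonempty fibre under \<Phi>.\<close>
    have "antipodal_relation \<rho>0 R \<longleftrightarrow> (\<exists>\<rho> \<in> Moeb \<rho>0. antipodal_pairs \<rho> = R)"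
      using that by (auto simp: antipodal_relation_def admissible_def)
    then show ?thesis
      using log_embed_image_eq_open_cell[OF card sep, of R] that by auto
  qed
  show "infnorm (log_embed \<rho>0 \<rho>1 - log_embed \<rho>0 \<rho>2) = dist_M \<rho>1 \<rho>2"
    if "\<rho>1 \<in> Moeb \<rho>0" "\<rho>2 \<in> Moeb \<rho>0" for \<rho>1 \<rho>2
    using infnorm_log_embed_diff[OF card sep] that by (simp add: Moeb_def)
  show "log_embed \<rho>0 ` {\<rho> \<in> Moeb \<rho>0. antipodal_pairs \<rho> = R} = open_cell \<rho>0 R"
    if "admissible R \<and> R \<noteq> {}" for R
    using log_embed_image_eq_open_cell[OF card sep] that by blast
  show "\<rho> \<in> Moeb \<rho>0" "R \<subseteq> antipodal_pairs \<rho>"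
    if "antipodal_relation \<rho>0 R" "\<rho> \<in> exp_map \<rho>0 ` closed_cell \<rho>0 R" for R \<rho>
    using exp_map_closed_cell[OF sep that(1)] that(2) by blast+
  show "closed_cell \<rho>0 R1 \<inter> closed_cell \<rho>0 R2 = closed_cell \<rho>0 (R1 \<union> R2)"
    if "admissible R1 \<and> admissible R2" for R1 R2
    using that by (intro closed_cell_Int) (auto simp: admissible_def)
qed

end
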